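(* Suppose that the $(\mathbb R\times\mathcal H)$-valued process $\begin{bmatrix} y_t\\ X_t\end{bmatrix}$ satisfies the structural vector autoregressive model $$\mathcal B\begin{bmatrix} y_t\\ X_t\end{bmatrix}=\mathcal A\begin{bmatrix} y_{t-1}\\ X_{t-1}\end{bmatrix}+\begin{bmatrix} u_{1t}\\ U_{2t}\end{bmatrix},\qquad \mathcal B=\begin{bmatrix} I_1&\beta_{12}\\ \beta_{21}& I_2\end{bmatrix},\quad \mathcal A=\begin{bmatrix}\alpha_{11}&\alpha_{12}\\ \alpha_{21}&\alpha_{22}\end{bmatrix},$$ where the covariance operator of $\begin{bmatrix} u_{1t}\\ U_{2t}\end{bmatrix}$ is $\mathbf\Sigma=\begin{bmatrix}\sigma_{11}&0\\ 0&\mathbf\Sigma_{22}\end{bmatrix}$. Then the structural parameters $(\mathcal A,\mathcal B,\mathbf\Sigma)$ are identified (that is, uniquely determined by the reduced-form parameters $(\Gamma,\Sigma_\varepsilon)$) under either of the following conditions: (i) $\beta_{12}=0$; or (ii) $\beta_{21}=0$ and $\mathbf\Sigma_{22}$ is injective.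
   Context: $\mathcal H=L^2[0,1]$ (real), and $\mathbb R\times\mathcal H$ is the product Hilbert space whose inner product is the sum of the two inner products. $y_t$ is real-valued and $X_t$ is $\mathcal H$-valued. Linear operators on $\mathbb R\times\mathcal H$ are written as $2\times2$ operator matrices acting as $\begin{bmatrix} d_{11}&d_{12}\\ d_{21}&d_{22}\end{bmatrix}\begin{bmatrix} y\\ x\end{bmatrix}=\begin{bmatrix} d_{11}y+d_{12}x\\ d_{21}y+d_{22}x\end{bmatrix}$. Here $I_1,I_2$ are the identity maps on $\mathbb R$ and $\mathcal H$; $\alpha_{11}:\mathbb R\to\mathbb R$; $\alpha_{12},\beta_{12}:\mathcal H\to\mathbb R$; $\alpha_{21},\beta_{21}:\mathbb R\to\mathcal H$; $\alpha_{22}:\mathcal H\to\mathcal H$ are (bounded) linear maps. The tensor product is $a\otimes b(\cdot)=\langle a,\cdot\rangle b$. The structural shocks are $u_{1t}$ (real-valued) and $U_{2t}$ ($\mathcal H$-valued), with $\sigma_{11}=\mathbb E[u_{1t}\otimes u_{1t}]$ (a linear map on $\mathbb R$, i.e. a scalar), $\mathbf\Sigma_{22}=\mathbb E[U_{2t}\otimes U_{2t}]$, and zero cross-covariances. Under either condition the operator $\mathcal B$ is invertible, and the reduced form is $$\begin{bmatrix} y_t\\ X_t\end{bmatrix}=\Gamma\begin{bmatrix} y_{t-1}\\ X_{t-1}\end{bmatrix}+\begin{bmatrix}\varepsilon_{1t}\\ \mathcal E_{2t}\end{bmatrix},\quad \Gamma=\mathcal B^{-1}\mathcal A,\quad \begin{bmatrix}\varepsilon_{1t}\\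 \mathcal E_{2t}\end{bmatrix}=\mathcal B^{-1}\begin{bmatrix}u_{1t}\\ U_{2t}\end{bmatrix}.$$ $\Sigma_\varepsilon$ denotes the covariance operator of $\begin{bmatrix}\varepsilon_{1t}\\ \mathcal E_{2t}\end{bmatrix}$. The reduced-form parameters are $(\Gamma,\Sigma_\varepsilon)$.
   Formalization: In condition (i) the formal statement additionally assumes σ11 ≠ 0; with σ11 = 0 the claim is false, since then β21 does not affect (Γ, Σ_ε) and is not determined by it. *)

theory Defs
  imports "HOL-Probability.Probability"
begin

section \<open>The real Hilbert space \<open>L\<^sup>2[0,1]\<close>\<close>

definition unit_interval :: "real measure" where
  "unit_interval = restrict_space lborel {0..1}"

definition square_integrable :: "(real \<Rightarrow> real) \<Rightarrow> bool" where
  "square_integrable f \<longleftrightarrow>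
     f \<in> borel_measurable unit_interval \<and> integrable unit_interval (\<lambda>x. (f x)\<^sup>2)"

lemma space_unit_interval [simp]: "space unit_interval = {0..1}"
  by (simp add: unit_interval_def space_restrict_space)

lemma prob_space_unit_interval: "prob_space unit_interval"
  by (rule prob_spaceI) (simp add: unit_interval_def emeasure_restrict_space space_restrict_space)

interpretation unit_interval: prob_space unit_interval
  by (rule prob_space_unit_interval)

lemma square_integrable_measurable [measurable_dest]:
  "square_integrable f \<Longrightarrow> f \<in> borel_measurable unit_interval"
  by (simp add: square_integrable_def)

lemma square_integrable_mult:
  assumes "square_integrable f" "square_integrable g"
  shows "integrable unit_interval (\<lambda>x. f x * g x)"
proof (rule Bochner_Integration.integrable_bound)
  show "integrable unit_interval (\<lambda>x. (f x)\<^sup>2 + (g x)\<^sup>2)"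
    using assms by (auto simp: square_integrable_def)
  show "(\<lambda>x. f x * g x) \<in> borel_measurable unit_interval"
    using assms by (auto simp: square_integrable_def)
  have "\<bar>a * b\<bar> \<le> a\<^sup>2 + b\<^sup>2" for a b :: real
    using sum_squares_bound[of "\<bar>a\<bar>" "\<bar>b\<bar>"] mult_nonneg_nonneg[of "\<bar>a\<bar>" "\<bar>b\<bar>"]
    unfolding abs_mult power2_abs by linarith
  then show "AE x in unit_interval. norm (f x * g x) \<le> norm ((f x)\<^sup>2 + (g x)\<^sup>2)"
    by (auto intro!: AE_I2)
qed

lemma square_integrable_add:
  assumes "square_integrable f" "square_integrable g"
  shows "square_integrable (\<lambda>x. f x + g x)"
  using assms square_integrable_mult[OF assms]
  by (auto simp: square_integrable_def power2_sum mult.assoc)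

lemma square_integrable_scale:
  "square_integrable f \<Longrightarrow> square_integrable (\<lambda>x. c * f x)"
  by (auto simp: square_integrable_def power_mult_distrib)

lemma square_integrable_uminus:
  "square_integrable f \<Longrightarrow> square_integrable (\<lambda>x. - f x)"
  by (auto simp: square_integrable_def)

lemma square_integrable_diff:
  "square_integrable f \<Longrightarrow> square_integrable g \<Longrightarrow> square_integrable (\<lambda>x. f x - g x)"
  using square_integrable_add[of f "\<lambda>x. - g x"] square_integrable_uminus by simp

lemma square_integrable_bounded:
  assumes [measurable]: "f \<in> borel_measurable unit_interval"
    and "\<And>x. x \<in> {0..1} \<Longrightarrow> \<bar>f x\<bar> \<le> B"
  shows "square_integrable f"
proof -
  have "(f x)\<^sup>2 \<le> B\<^sup>2" if "x \<in> {0..1}" for x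
    using power_mono[OF assms(2)[OF that], of 2] by simp
  then have "integrable unit_interval (\<lambda>x. (f x)\<^sup>2)"
    by (intro unit_interval.integrable_const_bound[where B = "B\<^sup>2"]) (auto intro!: AE_I2)
  then show ?thesis by (simp add: square_integrable_def)
qed

quotient_type L2 = "real \<Rightarrow> real" / partial:
  "\<lambda>f g. square_integrable f \<and> square_integrable g \<and> (AE x in unit_interval. f x = g x)"
proof (rule part_equivpI)
  show "\<exists>f. square_integrable f \<and> square_integrable f \<and> (AE x in unit_interval. f x = f x)"
    by (rule exI[of _ "\<lambda>_. 0"]) (auto simp: square_integrable_def)
  show "symp (\<lambda>f g. square_integrable f \<and> square_integrable g \<and> (AE x in unit_interval. f x = g x))"
    by (rule sympI) (auto simp: eq_commute)
  show "transp (\<lambda>f g. square_integrable f \<and> square_integrable g \<and> (AE x in unit_interval. f x = g x))"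
    by (rule transpI) (auto elim: eventually_elim2)
qed

instantiation L2 :: real_inner
begin

lift_definition zero_L2 :: L2 is "\<lambda>_. 0"
  by (simp add: square_integrable_def)

lift_definition plus_L2 :: "L2 \<Rightarrow> L2 \<Rightarrow> L2" is "\<lambda>f g x. f x + g x"
  by (auto intro: square_integrable_add)

lift_definition scaleR_L2 :: "real \<Rightarrow> L2 \<Rightarrow> L2" is "\<lambda>c f x. c * f x"
  by (auto intro: square_integrable_scale)

lift_definition uminus_L2 :: "L2 \<Rightarrow> L2" is "\<lambda>f x. - f x"
  by (auto simp: square_integrable_def)

lift_definition minus_L2 :: "L2 \<Rightarrow> L2 \<Rightarrow> L2" is "\<lambda>f g x. f x - g x"
  by (auto intro: square_integrable_diff)

lift_definition inner_L2 :: "L2 \<Rightarrow> L2 \<Rightarrow> real" is "\<lambda>f g. \<integral>x. f x * g x \<partial>unit_interval"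
  by (intro integral_cong_AE) (auto simp: square_integrable_def)

definition norm_L2 :: "L2 \<Rightarrow> real" where "norm_L2 f = sqrt (f \<bullet> f)"
definition sgn_L2 :: "L2 \<Rightarrow> L2" where "sgn_L2 f = scaleR (inverse (norm f)) f"
definition dist_L2 :: "L2 \<Rightarrow> L2 \<Rightarrow> real" where "dist_L2 f g = norm (f - g)"
definition uniformity_L2 :: "(L2 \<times> L2) filter" where
  "uniformity_L2 = (INF e\<in>{0 <..}. principal {(f, g). dist f g < e})"
definition open_L2 :: "L2 set \<Rightarrow> bool" where
  "open_L2 S = (\<forall>f\<in>S. \<forall>\<^sub>F (f', g) in uniformity. f' = f \<longrightarrow> g \<in> S)"

instance
proof
  fix a b c :: L2 and r s :: real
  note [simp] = square_integrable_add square_integrable_scale square_integrable_mult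
    square_integrable_diff square_integrable_uminus
  have [simp]: "square_integrable (\<lambda>_. 0)" by (simp add: square_integrable_def)
  show "a + b + c = a + (b + c)" by transfer (auto simp: add.assoc intro: square_integrable_add)
  show "a + b = b + a" by transfer (auto simp: add.commute intro: square_integrable_add)
  show "0 + a = a" by transfer auto
  show "- a + a = 0" by transfer auto
  show "a - b = a + - b" 
    by transfer auto
  show "r *\<^sub>R (a + b) = r *\<^sub>R a + r *\<^sub>R b" by transfer (auto simp: distrib_left)
  show "(r + s) *\<^sub>R a = r *\<^sub>R a + s *\<^sub>R a" by transfer (auto simp: distrib_right)
  show "r *\<^sub>R s *\<^sub>R a = (r * s) *\<^sub>R a" by transfer (auto simp: mult.assoc)
  show "1 *\<^sub>R a = a" by transfer auto
  show "dist a b = norm (a - b)" by (simp add: dist_L2_def)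
  show "sgn a = scaleR (inverse (norm a)) a" by (simp add: sgn_L2_def)
  show "uniformity = (INF e\<in>{0 <..}. principal {(x, y). dist x (y::L2) < e})"
    by (rule uniformity_L2_def)
  show "open U = (\<forall>x\<in>U. \<forall>\<^sub>F (x', y) in uniformity. x' = x \<longrightarrow> y \<in> U)" for U :: "L2 set"
    by (rule open_L2_def)
  show "a \<bullet> b = b \<bullet> a" by transfer (simp add: mult.commute)
  show "(a + b) \<bullet> c = a \<bullet> c + b \<bullet> c" by transfer (auto simp: distrib_right)
  show "(r *\<^sub>R a) \<bullet> b = r * (a \<bullet> b)" by transfer (auto simp: mult.assoc)
  show "0 \<le> a \<bullet> a" by transfer (auto intro!: integral_nonneg_AE)
  show "(a \<bullet> a = 0) = (a = 0)"
    by transfer (simp add: integral_nonneg_eq_0_iff_AE)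
  show "norm a = sqrt (a \<bullet> a)" by (simp add: norm_L2_def)
qed

end

lemma abs_L2_cases:
  obtains f where "square_integrable f" "x = abs_L2 f"
proof -
  have "square_integrable (rep_L2 x)"
    using Quotient3_rep_reflp[OF Quotient3_L2] by blast
  moreover have "x = abs_L2 (rep_L2 x)"
    using Quotient3_abs_rep[OF Quotient3_L2] by metis
  ultimately show ?thesis by (rule that)
qed

lemma inner_abs_L2:
  "square_integrable f \<Longrightarrow> square_integrable g \<Longrightarrow>
     abs_L2 f \<bullet> abs_L2 g = (\<integral>x. f x * g x \<partial>unit_interval)"
  by (simp add: inner_L2.abs_eq)

lemma minus_abs_L2:
  "square_integrable f \<Longrightarrow> square_integrable g \<Longrightarrow>
     abs_L2 f - abs_L2 g = abs_L2 (\<lambda>x. f x - g x)"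
  by (simp add: minus_L2.abs_eq)

lemma plus_abs_L2:
  "square_integrable f \<Longrightarrow> square_integrable g \<Longrightarrow>
     abs_L2 f + abs_L2 g = abs_L2 (\<lambda>x. f x + g x)"
  by (simp add: plus_L2.abs_eq)

lemma scaleR_abs_L2:
  "square_integrable f \<Longrightarrow> scaleR c (abs_L2 f) = abs_L2 (\<lambda>x. c * f x)"
  by (simp add: scaleR_L2.abs_eq)

lemma norm_abs_L2:
  "square_integrable f \<Longrightarrow> (norm (abs_L2 f))\<^sup>2 = (\<integral>x. (f x)\<^sup>2 \<partial>unit_interval)"
  unfolding power2_norm_eq_inner by (simp add: inner_abs_L2 power2_eq_square)

lemma square_integrable_const: "square_integrable (\<lambda>_. c)"
  by (simp add: square_integrable_def)

lemma square_integrable_abs: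
  "square_integrable f \<Longrightarrow> square_integrable (\<lambda>x. \<bar>f x\<bar>)"
  by (auto simp: square_integrable_def)

lemma square_integrable_imp_integrable:
  "square_integrable f \<Longrightarrow> integrable unit_interval f"
  using square_integrable_mult[OF _ square_integrable_const[of 1], of f] by simp

lemma integral_abs_le_norm_L2:
  assumes "square_integrable f"
  shows "(\<integral>x. \<bar>f x\<bar> \<partial>unit_interval) \<le> norm (abs_L2 f)"
proof -
  have 1: "norm (abs_L2 (\<lambda>_. 1)) = 1"
    using norm_abs_L2[OF square_integrable_const[of 1]] unit_interval.prob_space
    by (simp add: power2_eq_1_iff) (smt (verit) norm_ge_zero)
  have 2: "norm (abs_L2 (\<lambda>x. \<bar>f x\<bar>)) = norm (abs_L2 f)"
    using norm_abs_L2[OF square_integrable_abs[OF assms]] norm_abs_L2[OF assms]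
    by (intro power2_eq_imp_eq[OF _ norm_ge_zero norm_ge_zero]) simp
  have "(\<integral>x. \<bar>f x\<bar> \<partial>unit_interval) = abs_L2 (\<lambda>x. \<bar>f x\<bar>) \<bullet> abs_L2 (\<lambda>_. 1)"
    using assms by (simp add: inner_abs_L2 square_integrable_abs square_integrable_const)
  also have "\<dots> \<le> norm (abs_L2 (\<lambda>x. \<bar>f x\<bar>)) * norm (abs_L2 (\<lambda>_. 1))"
    by (rule norm_cauchy_schwarz)
  finally show ?thesis by (simp add: 1 2)
qed

instance L2 :: complete_space
proof
  fix X :: "nat \<Rightarrow> L2" assume "Cauchy X"
  have "\<exists>F. square_integrable F \<and> X n = abs_L2 F" for n
    using abs_L2_cases[of "X n"] by metis
  then obtain F where sqF: "\<And>n. square_integrable (F n)" and XF: "\<And>n. X n = abs_L2 (F n)"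
    by metis
  have "\<exists>N. \<forall>m\<ge>N. \<forall>n\<ge>N. dist (X m) (X n) < (1/2)^k" for k
    using metric_CauchyD[OF \<open>Cauchy X\<close>, of "(1/2)^k"] by simp
  then obtain N where N: "\<And>k m n. m \<ge> N k \<Longrightarrow> n \<ge> N k \<Longrightarrow> dist (X m) (X n) < (1/2)^k"
    by metis
  define r where "r k = (\<Sum>i\<le>k. N i) + k" for k
  have rN: "N k \<le> r k" for k
    unfolding r_def using member_le_sum[of k "{..k}" N] by simp
  have rmono: "i \<le> j \<Longrightarrow> r i \<le> r j" for i j
    unfolding r_def by (intro add_mono sum_mono2) auto
  have near: "dist (X m) (X (r k)) < (1/2)^k" if "m \<ge> r k" for m k
    using N[of k m "r k"] rN[of k] that by simp
  define G where "G k = F (r k)" for k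
  have sqG: "square_integrable (G k)" for k by (simp add: G_def sqF)
  note [measurable] = sqG[THEN square_integrable_measurable]
  have XG: "X (r k) = abs_L2 (G k)" for k by (simp add: G_def XF)
  have normG: "norm (abs_L2 (\<lambda>x. G j x - G k x)) \<le> (1/2)^k" if "k \<le> j" for j k
    using near[OF rmono[OF that]] by (simp add: XG dist_norm minus_abs_L2 sqG)
  have sqd: "square_integrable (\<lambda>x. G j x - G k x)" for j k
    by (intro square_integrable_diff sqG)
  have "(\<integral>\<^sup>+x. (\<Sum>k. ennreal \<bar>G (Suc k) x - G k x\<bar>) \<partial>unit_interval)
      = (\<Sum>k. \<integral>\<^sup>+x. ennreal \<bar>G (Suc k) x - G k x\<bar> \<partial>unit_interval)"
    by (rule nn_integral_suminf) measurable
  also have "\<dots> \<le> (\<Sum>k. ennreal ((1/2)^k))"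
  proof (intro suminf_le)
    fix k
    have "(\<integral>\<^sup>+x. ennreal \<bar>G (Suc k) x - G k x\<bar> \<partial>unit_interval)
        = ennreal (\<integral>x. \<bar>G (Suc k) x - G k x\<bar> \<partial>unit_interval)"
      by (intro nn_integral_eq_integral square_integrable_imp_integrable square_integrable_abs sqd) auto
    also have "\<dots> \<le> ennreal ((1/2)^k)"
      by (intro ennreal_leI order_trans[OF integral_abs_le_norm_L2[OF sqd] normG]) simp
    finally show "(\<integral>\<^sup>+x. ennreal \<bar>G (Suc k) x - G k x\<bar> \<partial>unit_interval) \<le> ennreal ((1/2)^k)" .
  qed auto
  also have "\<dots> = ennreal (\<Sum>k. (1/2)^k)"
    by (rule suminf_ennreal2) (auto intro: summable_geometric)
  also have "\<dots> < \<infinity>" by simp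
  finally have fin: "(\<integral>\<^sup>+x. (\<Sum>k. ennreal \<bar>G (Suc k) x - G k x\<bar>) \<partial>unit_interval) \<noteq> \<infinity>" by simp
  have "AE x in unit_interval. (\<Sum>k. ennreal \<bar>G (Suc k) x - G k x\<bar>) \<noteq> \<infinity>"
    by (rule nn_integral_PInf_AE[OF _ fin]) measurable
  then have conv: "AE x in unit_interval. convergent (\<lambda>k. G k x)"
  proof eventually_elim
    fix x assume "(\<Sum>k. ennreal \<bar>G (Suc k) x - G k x\<bar>) \<noteq> \<infinity>"
    then have "summable (\<lambda>k. \<bar>G (Suc k) x - G k x\<bar>)"
      by (intro summable_suminf_not_top) auto
    then have "summable (\<lambda>k. G (Suc k) x - G k x)"
      by (rule summable_rabs_cancel)
    then have "convergent (\<lambda>n. \<Sum>k<n. G (Suc k) x - G k x)"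
      by (simp add: summable_iff_convergent)
    then have "convergent (\<lambda>n. G n x - G 0 x)"
      unfolding sum_lessThan_telescope[of "\<lambda>k. G k x"] .
    then have "convergent (\<lambda>n. (G n x - G 0 x) + G 0 x)"
      by (intro convergent_add convergent_const)
    then show "convergent (\<lambda>k. G k x)" by simp
  qed
  define g where "g x = lim (\<lambda>k. G k x)" for x
  have [measurable]: "g \<in> borel_measurable unit_interval"
    unfolding g_def by measurable
  have bound: "(\<integral>\<^sup>+x. ennreal ((g x - G k x)\<^sup>2) \<partial>unit_interval) \<le> ennreal (((1/2)^k)\<^sup>2)" for k
  proof -
    have "(\<integral>\<^sup>+x. ennreal ((g x - G k x)\<^sup>2) \<partial>unit_interval)
        = (\<integral>\<^sup>+x. liminf (\<lambda>j. ennreal ((G j x - G k x)\<^sup>2)) \<partial>unit_interval)"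
    proof (rule nn_integral_cong_AE, use conv in eventually_elim)
      fix x assume "convergent (\<lambda>k. G k x)"
      then have "(\<lambda>j. G j x) \<longlonglongrightarrow> g x" by (simp add: convergent_LIMSEQ_iff g_def)
      then have "(\<lambda>j. ennreal ((G j x - G k x)\<^sup>2)) \<longlonglongrightarrow> ennreal ((g x - G k x)\<^sup>2)"
        by (intro tendsto_intros)
      then show "ennreal ((g x - G k x)\<^sup>2) = liminf (\<lambda>j. ennreal ((G j x - G k x)\<^sup>2))"
        by (intro lim_imp_Liminf[symmetric]) auto
    qed
    also have "\<dots> \<le> liminf (\<lambda>j. \<integral>\<^sup>+x. ennreal ((G j x - G k x)\<^sup>2) \<partial>unit_interval)"
      by (rule nn_integral_liminf) measurable
    also have "\<dots> \<le> ennreal (((1/2)^k)\<^sup>2)"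
    proof (intro Liminf_le eventually_sequentiallyI[of k])
      fix j assume "k \<le> j"
      have "(\<integral>\<^sup>+x. ennreal ((G j x - G k x)\<^sup>2) \<partial>unit_interval)
          = ennreal ((norm (abs_L2 (\<lambda>x. G j x - G k x)))\<^sup>2)"
        using sqd[of j k] by (subst nn_integral_eq_integral) (auto simp: norm_abs_L2 square_integrable_def)
      also have "\<dots> \<le> ennreal (((1/2)^k)\<^sup>2)"
        by (intro ennreal_leI power_mono normG \<open>k \<le> j\<close>) simp
      finally show "(\<integral>\<^sup>+x. ennreal ((G j x - G k x)\<^sup>2) \<partial>unit_interval) \<le> ennreal (((1/2)^k)\<^sup>2)" .
    qed auto
    finally show ?thesis .
  qed
  have sqgG: "square_integrable (\<lambda>x. g x - G k x)" for k
    unfolding square_integrable_def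
  proof
    show "integrable unit_interval (\<lambda>x. (g x - G k x)\<^sup>2)"
      using le_less_trans[OF bound[of k] ennreal_less_top] by (intro integrableI_nonneg) auto
  qed measurable
  have sqg: "square_integrable g"
    using square_integrable_add[OF sqgG[of 0] sqG[of 0]] by simp
  have lim: "dist (abs_L2 g) (X (r k)) \<le> (1/2)^k" for k
  proof -
    have "ennreal ((norm (abs_L2 (\<lambda>x. g x - G k x)))\<^sup>2) \<le> ennreal (((1/2)^k)\<^sup>2)"
      using bound[of k] sqgG[of k]
      by (subst (asm) nn_integral_eq_integral) (auto simp: norm_abs_L2 square_integrable_def)
    then have "(norm (abs_L2 (\<lambda>x. g x - G k x)))\<^sup>2 \<le> ((1/2)^k)\<^sup>2"
      by (simp add: ennreal_le_iff)
    then have "norm (abs_L2 (\<lambda>x. g x - G k x)) \<le> (1/2)^k"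
      by (rule power2_le_imp_le) simp
    then show ?thesis by (simp add: XG dist_norm minus_abs_L2 sqg sqG)
  qed
  have "X \<longlonglongrightarrow> abs_L2 g"
  proof (rule metric_LIMSEQ_I)
    fix e :: real assume "0 < e"
    then obtain k where k: "(1/2)^k < e / 2"
      using real_arch_pow_inv[of "e/2" "1/2"] by auto
    have "dist (X m) (abs_L2 g) < e" if "m \<ge> r k" for m
      using near[OF that] lim[of k] k dist_triangle[of "X m" "abs_L2 g" "X (r k)"]
      by (simp add: dist_commute)
    then show "\<exists>no. \<forall>n\<ge>no. dist (X n) (abs_L2 g) < e" by blast
  qed
  then show "convergent X" by (rule convergentI)
qed

instance L2 :: banach ..

definition ind_L2 :: "real set \<Rightarrow> L2" where
  "ind_L2 A = abs_L2 (indicator A)"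

lemma square_integrable_indicator:
  assumes [measurable]: "A \<in> sets unit_interval"
  shows "square_integrable (indicator A)"
proof (rule square_integrable_bounded)
  show "(indicator A :: real \<Rightarrow> real) \<in> borel_measurable unit_interval" by measurable
  show "\<bar>indicator A x\<bar> \<le> (1::real)" for x by (simp add: indicator_def)
qed

definition rat_step_L2 :: "(rat \<times> rat) list \<Rightarrow> L2" where
  "rat_step_L2 cs = (\<Sum>(c, q)\<leftarrow>cs. of_rat c *\<^sub>R ind_L2 ({0..1} \<inter> {..of_rat q}))"

lemma closure_limit:
  fixes s :: "nat \<Rightarrow> 'a::first_countable_topology"
  assumes "\<And>n. s n \<in> D" "s \<longlonglongrightarrow> f"
  shows "f \<in> closure D"
  unfolding closure_sequential using assms by (intro exI[of _ s]) simp

lemma closure_rat_step_add: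
  assumes "f \<in> closure (range rat_step_L2)" "g \<in> closure (range rat_step_L2)"
  shows "f + g \<in> closure (range rat_step_L2)"
proof -
  obtain s t where s: "\<And>n. s n \<in> range rat_step_L2" "s \<longlonglongrightarrow> f"
    and t: "\<And>n. t n \<in> range rat_step_L2" "t \<longlonglongrightarrow> g"
    using assms unfolding closure_sequential by metis
  have "s n + t n \<in> range rat_step_L2" for n
  proof -
    obtain cs ds where "s n = rat_step_L2 cs" "t n = rat_step_L2 ds" using s(1) t(1) by (metis imageE)
    then have "s n + t n = rat_step_L2 (cs @ ds)" by (simp add: rat_step_L2_def)
    then show ?thesis by blast
  qed
  moreover have "(\<lambda>n. s n + t n) \<longlonglongrightarrow> f + g" by (rule tendsto_add[OF s(2) t(2)])
  ultimately show ?thesis by (rule closure_limit)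
qed

lemma rat_step_scale:
  "of_rat c *\<^sub>R rat_step_L2 cs = rat_step_L2 (map (\<lambda>(d, q). (c * d, q)) cs)"
  by (induction cs) (auto simp: rat_step_L2_def scaleR_add_right of_rat_mult)

lemma closure_rat_step_scale:
  assumes "f \<in> closure (range rat_step_L2)"
  shows "c *\<^sub>R f \<in> closure (range rat_step_L2)"
proof -
  obtain s where s: "\<And>n. s n \<in> range rat_step_L2" "s \<longlonglongrightarrow> f"
    using assms unfolding closure_sequential by metis
  have "c \<in> closure \<rat>"
    by (simp add: Rats_closure_real)
  then obtain d where d: "\<And>n. d n \<in> \<rat>" "d \<longlonglongrightarrow> c"
    unfolding closure_sequential by metis
  have "d n *\<^sub>R s n \<in> range rat_step_L2" for n
  proof -
    obtain cs where "s n = rat_step_L2 cs" using s(1) by (metis imageE)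
    moreover obtain q where "d n = of_rat q" using d(1)[of n] by (blast elim: Rats_cases)
    ultimately have "d n *\<^sub>R s n = rat_step_L2 (map (\<lambda>(d, p). (q * d, p)) cs)" by (simp add: rat_step_scale)
    then show ?thesis by blast
  qed
  moreover have "(\<lambda>n. d n *\<^sub>R s n) \<longlonglongrightarrow> c *\<^sub>R f" by (rule tendsto_scaleR[OF d(2) s(2)])
  ultimately show ?thesis by (rule closure_limit)
qed

lemma closure_rat_step_zero: "0 \<in> closure (range rat_step_L2)"
proof -
  have "rat_step_L2 [] = 0" by (simp add: rat_step_L2_def)
  then have "0 \<in> range rat_step_L2" by (metis rangeI)
  then show ?thesis by (rule closure_subset[THEN subsetD])
qed

lemma closure_rat_step_sum:
  "finite I \<Longrightarrow> (\<And>i. i \<in> I \<Longrightarrow> f i \<in> closure (range rat_step_L2)) \<Longrightarrow>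
     sum f I \<in> closure (range rat_step_L2)"
  by (induction I rule: finite_induct) (auto intro: closure_rat_step_zero closure_rat_step_add)

lemma closure_rat_step_limit:
  assumes "\<And>n. s n \<in> closure (range rat_step_L2)" "s \<longlonglongrightarrow> f"
  shows "f \<in> closure (range rat_step_L2)"
  by (rule closed_sequentially[OF closed_closure assms])

lemma norm_minus_abs_L2:
  "square_integrable f \<Longrightarrow> square_integrable g \<Longrightarrow>
     (norm (abs_L2 f - abs_L2 g))\<^sup>2 = (\<integral>x. (f x - g x)\<^sup>2 \<partial>unit_interval)"
  by (simp add: minus_abs_L2 norm_abs_L2 square_integrable_diff)

lemma tendsto_abs_L2:
  assumes "square_integrable f" "\<And>n. square_integrable (s n)"
    and "square_integrable w"
    and "\<And>x. x \<in> {0..1} \<Longrightarrow> (\<lambda>n. s n x) \<longlonglongrightarrow> f x"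
    and "\<And>n x. x \<in> {0..1} \<Longrightarrow> \<bar>s n x\<bar> \<le> w x"
  shows "(\<lambda>n. abs_L2 (s n)) \<longlonglongrightarrow> abs_L2 f"
proof -
  note [measurable] = assms(1-3)[THEN square_integrable_measurable]
  have f_le: "\<bar>f x\<bar> \<le> w x" if "x \<in> {0..1}" for x
    using LIMSEQ_le_const2[OF tendsto_rabs[OF assms(4)[OF that]]] assms(5)[OF that] by blast
  have "(\<lambda>n. \<integral>x. (s n x - f x)\<^sup>2 \<partial>unit_interval) \<longlonglongrightarrow> (\<integral>x. 0 \<partial>unit_interval)"
  proof (rule integral_dominated_convergence)
    show "integrable unit_interval (\<lambda>x. (2 * w x)\<^sup>2)"
      using square_integrable_scale[OF assms(3), of 2] by (simp add: square_integrable_def)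
    show "AE x in unit_interval. (\<lambda>n. (s n x - f x)\<^sup>2) \<longlonglongrightarrow> 0"
    proof (rule AE_I2)
      fix x assume "x \<in> space unit_interval"
      then have "(\<lambda>n. (s n x - f x)\<^sup>2) \<longlonglongrightarrow> (f x - f x)\<^sup>2"
        by (intro tendsto_intros assms(4)) simp
      then show "(\<lambda>n. (s n x - f x)\<^sup>2) \<longlonglongrightarrow> 0" by simp
    qed
    show "AE x in unit_interval. norm ((s n x - f x)\<^sup>2) \<le> (2 * w x)\<^sup>2" for n
    proof (rule AE_I2)
      fix x assume "x \<in> space unit_interval"
      then have "\<bar>s n x - f x\<bar> \<le> 2 * w x"
        using assms(5)[of x n] f_le[of x] by simp
      then show "norm ((s n x - f x)\<^sup>2) \<le> (2 * w x)\<^sup>2"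
        using power_mono[of "\<bar>s n x - f x\<bar>" "2 * w x" 2] by simp
    qed
  qed measurable
  then have "(\<lambda>n. (norm (abs_L2 (s n) - abs_L2 f))\<^sup>2) \<longlonglongrightarrow> 0"
    by (simp add: norm_minus_abs_L2 assms)
  then have "(\<lambda>n. sqrt ((norm (abs_L2 (s n) - abs_L2 f))\<^sup>2)) \<longlonglongrightarrow> sqrt 0"
    by (rule tendsto_real_sqrt)
  then have "(\<lambda>n. norm (abs_L2 (s n) - abs_L2 f)) \<longlonglongrightarrow> 0" by simp
  then show ?thesis by (simp add: tendsto_norm_zero_iff LIM_zero_iff)
qed

lemma sets_unit_interval_sigma:
  "sets unit_interval = sigma_sets {0..1} (range (\<lambda>a::real. {0..1} \<inter> {..a}))"
proof -
  have "sets unit_interval = sets (vimage_algebra {0..1} (\<lambda>x. x) (lborel :: real measure))"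
    unfolding unit_interval_def by (rule restrict_space_eq_vimage_algebra) simp
  also have "\<dots> = sets (vimage_algebra {0..1} (\<lambda>x. x) (borel :: real measure))"
    by (rule sets_vimage_algebra_cong) simp
  also have "vimage_algebra {0..1} (\<lambda>x. x) (borel :: real measure)
      = sigma {0..1} {(\<lambda>x. x) -` A \<inter> {0..1} |A. A \<in> range (\<lambda>a::real. {..a})}"
    unfolding borel_eq_atMost by (rule vimage_algebra_sigma) auto
  also have "{(\<lambda>x. x) -` A \<inter> {0..1} |A. A \<in> range (\<lambda>a::real. {..a})}
      = range (\<lambda>a::real. {0..1} \<inter> {..a})"
    by blast
  finally show ?thesis by (subst (asm) sets_measure_of) auto
qed

lemma ind_L2_empty: "ind_L2 {} = 0"
proof -
  have "(indicator {} :: real \<Rightarrow> real) = (\<lambda>_. 0)" by auto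
  then show ?thesis unfolding ind_L2_def zero_L2_def by simp
qed

lemma Int_atMost_in_sets: "{0..1} \<inter> {..a} \<in> sets unit_interval" for a :: real
  unfolding sets_unit_interval_sigma by (intro sigma_sets.Basic) blast

lemma ind_L2_Int_atMost: "ind_L2 ({0..1} \<inter> {..a}) \<in> closure (range rat_step_L2)"
proof -
  have "\<exists>q::rat. a < of_rat q \<and> of_rat q < a + 1 / Suc n" for n
    by (rule of_rat_dense) simp
  then obtain q :: "nat \<Rightarrow> rat" where q: "\<And>n. a < of_rat (q n)" "\<And>n. of_rat (q n) < a + 1 / Suc n"
    by metis
  have "(\<lambda>n. abs_L2 (indicator ({0..1} \<inter> {..of_rat (q n)}))) \<longlonglongrightarrow> abs_L2 (indicator ({0..1} \<inter> {..a}))"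
  proof (rule tendsto_abs_L2[where w = "\<lambda>_. 1"])
    fix x :: real assume "x \<in> {0..1}"
    have "\<forall>\<^sub>F n in sequentially. (indicator ({0..1} \<inter> {..of_rat (q n)}) x :: real) = indicator ({0..1} \<inter> {..a}) x"
    proof (cases "x \<le> a")
      case True
      then have "x \<le> of_rat (q n)" for n using q(1)[of n] by linarith
      with True show ?thesis by (simp add: indicator_def)
    next
      case False
      then obtain m where m: "1 / Suc m < x - a" using nat_approx_posE[of "x - a"] by auto
      have "\<not> x \<le> of_rat (q n)" if "m \<le> n" for n
      proof -
        have "1 / real (Suc n) \<le> 1 / Suc m" using that by (intro divide_left_mono) auto
        then show ?thesis using q(2)[of n] m by linarith
      qed
      then show ?thesis
        using False by (intro eventually_sequentiallyI[of m]) (simp add: indicator_def)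
    qed
    then show "(\<lambda>n. indicator ({0..1} \<inter> {..of_rat (q n)}) x :: real) \<longlonglongrightarrow> indicator ({0..1} \<inter> {..a}) x"
      by (rule tendsto_eventually)
    show "\<bar>indicator ({0..1} \<inter> {..of_rat (q n)}) x\<bar> \<le> (1::real)" for n and x :: real
      by (simp add: indicator_def)
  qed (intro square_integrable_indicator Int_atMost_in_sets square_integrable_const)+
  moreover have "abs_L2 (indicator ({0..1} \<inter> {..of_rat (q n)})) \<in> closure (range rat_step_L2)" for n
  proof -
    have "abs_L2 (indicator ({0..1} \<inter> {..of_rat (q n)})) = rat_step_L2 [(1, q n)]"
      by (simp add: rat_step_L2_def ind_L2_def)
    then show ?thesis by (metis rangeI closure_subset subsetD)
  qed
  ultimately show ?thesis
    unfolding ind_L2_def by (rule closure_rat_step_limit[rotated])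
qed

lemma ind_L2_in_closure:
  assumes "A \<in> sets unit_interval"
  shows "ind_L2 A \<in> closure (range rat_step_L2)"
proof -
  let ?G = "range (\<lambda>a::real. {0..1} \<inter> {..a})"
  have sets_iff: "sigma_sets {0..1} ?G = sets unit_interval" by (rule sets_unit_interval_sigma[symmetric])
  have A: "A \<in> sigma_sets {0..1} ?G" using assms unfolding sets_iff .
  have G: "ind_L2 B \<in> closure (range rat_step_L2)" if "B \<in> ?G" for B
    using that ind_L2_Int_atMost by blast
  have "Int_stable ?G"
  proof (rule Int_stableI)
    fix X Y assume "X \<in> ?G" "Y \<in> ?G"
    then obtain a b where "X = {0..1} \<inter> {..a}" "Y = {0..1} \<inter> {..b}" by blast
    then have "X \<inter> Y = {0..1} \<inter> {..min a b}" by auto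
    then show "X \<inter> Y \<in> ?G" by (rule image_eqI) simp
  qed
  moreover have "?G \<subseteq> Pow {0..1}" by blast
  ultimately show ?thesis using A
  proof (induction A rule: sigma_sets_induct_disjoint)
    case (basic A)
    then show ?case by (rule G)
  next
    case empty
    show ?case by (simp add: ind_L2_empty closure_rat_step_zero)
  next
    case (compl A)
    then have A: "A \<in> sets unit_interval" unfolding sets_iff by blast
    have "{0..1} \<in> ?G" by (rule image_eqI[of _ _ 1]) auto
    then have top: "ind_L2 {0..1} \<in> closure (range rat_step_L2)" by (rule G)
    have U: "{0..1} \<in> sets unit_interval" using sets.top[of unit_interval] by simp
    have "ind_L2 ({0..1} - A) = ind_L2 {0..1} + (- 1) *\<^sub>R ind_L2 A"
    proof -
      have "(\<lambda>x. indicator {0..1} x - indicator A x) = (indicator ({0..1} - A) :: real \<Rightarrow> real)"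
        using sets.sets_into_space[OF A] by (auto simp: indicator_def fun_eq_iff)
      then show ?thesis
        using minus_abs_L2[OF square_integrable_indicator[OF U] square_integrable_indicator[OF A]]
        by (simp add: ind_L2_def)
    qed
    then show ?case
      using closure_rat_step_add[OF top closure_rat_step_scale[OF compl(2), of "-1"]] by simp
  next
    case (union A)
    then have A: "A i \<in> sets unit_interval" for i unfolding sets_iff by blast
    have sq: "square_integrable (indicator (\<Union>i<n. A i))" for n
      by (intro square_integrable_indicator) (auto intro: A)
    have fin: "ind_L2 (\<Union>i<n. A i) \<in> closure (range rat_step_L2)" for n
    proof (induction n)
      case 0
      show ?case by (simp add: ind_L2_empty closure_rat_step_zero)
    next
      case (Suc n)
      have "A i \<inter> A n = {}" if "i < n" for i
        using union(1) that by (auto simp: disjoint_family_on_def)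
      then have "(\<lambda>x. indicator (\<Union>i<n. A i) x + indicator (A n) x)
          = (indicator (\<Union>i<Suc n. A i) :: real \<Rightarrow> real)"
        by (auto simp: fun_eq_iff indicator_def lessThan_Suc)
      then have "ind_L2 (\<Union>i<Suc n. A i) = ind_L2 (\<Union>i<n. A i) + ind_L2 (A n)"
        using plus_abs_L2[OF sq square_integrable_indicator[OF A]] by (simp add: ind_L2_def)
      then show ?case using Suc union(3)[of n] by (simp add: closure_rat_step_add)
    qed
    have "(\<lambda>n. abs_L2 (indicator (\<Union>i<n. A i))) \<longlonglongrightarrow> abs_L2 (indicator (\<Union>i. A i))"
    proof (rule tendsto_abs_L2[where w = "\<lambda>_. 1"])
      show "(\<lambda>n. indicator (\<Union>i<n. A i) x :: real) \<longlonglongrightarrow> indicator (\<Union>i. A i) x" for x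
        by (rule LIMSEQ_indicator_UN)
      show "square_integrable (indicator (\<Union>i. A i))"
        by (intro square_integrable_indicator) (auto intro: A)
    qed (auto simp: sq square_integrable_const indicator_def)
    then show ?case
      unfolding ind_L2_def by (rule closure_rat_step_limit[OF fin[unfolded ind_L2_def]])
  qed
qed

lemma abs_L2_sum:
  assumes "finite Z" "\<And>y. square_integrable (h y)"
  shows "square_integrable (\<lambda>x. \<Sum>y\<in>Z. h y x) \<and>
    abs_L2 (\<lambda>x. \<Sum>y\<in>Z. h y x) = (\<Sum>y\<in>Z. abs_L2 (h y))"
  using assms(1)
proof induction
  case empty
  show ?case by (simp add: square_integrable_const zero_L2_def)
next
  case (insert z Z)
  then show ?case
    using plus_abs_L2[OF assms(2)[of z], of "\<lambda>x. \<Sum>y\<in>Z. h y x"]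
    by (auto intro: square_integrable_add assms(2))
qed

lemma closure_rat_step: "closure (range rat_step_L2) = UNIV"
proof -
  have "u \<in> closure (range rat_step_L2)" for u
  proof -
    obtain f where sqf: "square_integrable f" and u: "u = abs_L2 f" by (rule abs_L2_cases)
    have "\<exists>s. (\<forall>n. simple_function unit_interval (s n)) \<and>
        (\<forall>x\<in>space unit_interval. (\<lambda>n. s n x) \<longlonglongrightarrow> f x) \<and>
        (\<forall>n. \<forall>x\<in>space unit_interval. dist (s n x) 0 \<le> 2 * dist (f x) 0)"
      by (rule borel_measurable_implies_sequence_metric[OF square_integrable_measurable[OF sqf]])
    then obtain s where simple: "\<And>n. simple_function unit_interval (s n)"
      and lim: "\<And>x. x \<in> {0..1} \<Longrightarrow> (\<lambda>n. s n x) \<longlonglongrightarrow> f x"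
      and bnd: "\<And>n x. x \<in> {0..1} \<Longrightarrow> \<bar>s n x\<bar> \<le> 2 * \<bar>f x\<bar>"
      unfolding space_unit_interval dist_real_def diff_0_right by blast
    have step: "square_integrable (s n) \<and> abs_L2 (s n) \<in> closure (range rat_step_L2)" for n
    proof -
      let ?Y = "s n ` {0..1}" and ?B = "\<lambda>y. s n -` {y} \<inter> {0..1}"
      have finY: "finite ?Y" using simple_functionD(1)[OF simple[of n]] by simp
      have B: "?B y \<in> sets unit_interval" for y using simple_functionD(2)[OF simple[of n], of "{y}"] by simp
      have part: "square_integrable (\<lambda>x. \<Sum>y\<in>Z. y * indicator (?B y) x) \<and>
         abs_L2 (\<lambda>x. \<Sum>y\<in>Z. y * indicator (?B y) x) = (\<Sum>y\<in>Z. y *\<^sub>R ind_L2 (?B y))" if "finite Z" for Z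
      proof -
        have sq: "square_integrable (\<lambda>x. y * indicator (?B y) x)" for y
          by (intro square_integrable_scale square_integrable_indicator B)
        show ?thesis
          using abs_L2_sum[OF that, of "\<lambda>y x. y * indicator (?B y) x", OF sq]
          unfolding ind_L2_def scaleR_abs_L2[OF square_integrable_indicator[OF B]] .
      qed
      have eq: "AE x in unit_interval. (\<Sum>y\<in>?Y. y * indicator (?B y) x) = s n x"
      proof (rule AE_I2)
        fix x assume "x \<in> space unit_interval"
        then have x: "x \<in> {0..1}" by simp
        have "(\<Sum>y\<in>?Y. y * indicator (?B y) x) = (\<Sum>y\<in>?Y. if y = s n x then y else 0)"
          using x by (intro sum.cong) (auto simp: indicator_def)
        also have "\<dots> = s n x" using x finY by (simp add: sum.delta)
        finally show "(\<Sum>y\<in>?Y. y * indicator (?B y) x) = s n x" .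
      qed
      have sq: "square_integrable (s n)"
      proof (rule square_integrable_bounded)
        show "s n \<in> borel_measurable unit_interval" by (rule borel_measurable_simple_function[OF simple])
        show "\<bar>s n x\<bar> \<le> Max (abs ` ?Y)" if "x \<in> {0..1}" for x
          using that finY by (intro Max_ge) auto
      qed
      have "abs_L2 (s n) = abs_L2 (\<lambda>x. \<Sum>y\<in>?Y. y * indicator (?B y) x)"
        using sq part[OF finY] eq by (intro Quotient3_rel_abs[OF Quotient3_L2]) (auto elim: eventually_mono)
      also have "\<dots> = (\<Sum>y\<in>?Y. y *\<^sub>R ind_L2 (?B y))" using part[OF finY] by blast
      also have "\<dots> \<in> closure (range rat_step_L2)"
        by (intro closure_rat_step_sum finY closure_rat_step_scale ind_L2_in_closure B)
      finally show ?thesis using sq by blast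
    qed
    have "(\<lambda>n. abs_L2 (s n)) \<longlonglongrightarrow> u"
      unfolding u
      by (rule tendsto_abs_L2[where w = "\<lambda>x. 2 * \<bar>f x\<bar>"])
        (use sqf step lim bnd in \<open>auto intro: square_integrable_scale square_integrable_abs\<close>)
    then show ?thesis by (rule closure_rat_step_limit[rotated]) (use step in blast)
  qed
  then show ?thesis by blast
qed

instance L2 :: second_countable_topology
proof
  let ?D = "range rat_step_L2"
  let ?B = "(\<lambda>(d, n::nat). ball d (1 / Suc n)) ` (?D \<times> UNIV)"
  have "topological_basis ?B"
  proof (rule topological_basisI)
    fix S and u :: L2 assume "open S" "u \<in> S"
    then obtain e where e: "e > 0" "ball u e \<subseteq> S" using open_contains_ball by blast
    obtain n where n: "1 / Suc n < e / 2" using nat_approx_posE[of "e/2"] e by auto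
    have "u \<in> closure ?D" by (simp add: closure_rat_step)
    then have "\<exists>d\<in>?D. dist d u < 1 / Suc n"
      unfolding closure_approachable by (rule allE[of _ "1 / Suc n"]) simp
    then obtain d where d: "d \<in> ?D" "dist d u < 1 / Suc n" by blast
    have "ball d (1 / Suc n) \<subseteq> ball u e"
    proof
      fix v assume "v \<in> ball d (1 / Suc n)"
      then show "v \<in> ball u e"
        using d(2) n dist_triangle[of u v d] by (simp add: dist_commute)
    qed
    then have "u \<in> ball d (1 / Suc n)" "ball d (1 / Suc n) \<subseteq> S"
      using e(2) d(2) by auto
    moreover have "ball d (1 / Suc n) \<in> ?B" using d(1) by (intro image_eqI[of _ _ "(d, n)"]) simp_all
    ultimately show "\<exists>B'\<in>?B. u \<in> B' \<and> B' \<subseteq> S"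
      by (intro bexI[of _ "ball d (1 / Suc n)"] conjI)
  next
    fix B' assume "B' \<in> ?B"
    then show "open B'" by (elim imageE) (simp add: case_prod_unfold)
  qed
  moreover have "countable ?B" by (intro countable_image countable_SIGMA) auto
  ultimately show "\<exists>B::L2 set set. countable B \<and> open = generate_topology B"
    using topological_basis_imp_subbasis by blast
qed

section \<open>Operator matrices on \<open>\<real> \<times> L\<^sup>2[0,1]\<close>\<close>

type_synonym RH_op = "(real \<times> L2) \<Rightarrow>\<^sub>L (real \<times> L2)"

definition op_matrix ::
  "(real \<Rightarrow>\<^sub>L real) \<Rightarrow> (L2 \<Rightarrow>\<^sub>L real) \<Rightarrow> (real \<Rightarrow>\<^sub>L L2) \<Rightarrow> (L2 \<Rightarrow>\<^sub>L L2) \<Rightarrow>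
     RH_op" where
  "op_matrix d11 d12 d21 d22 = Blinfun (\<lambda>(y, x). (d11 y + d12 x, d21 y + d22 x))"

lemma op_matrix_apply [simp]:
  "op_matrix d11 d12 d21 d22 (y, x) = (d11 y + d12 x, d21 y + d22 x)"
proof -
  have "bounded_linear (\<lambda>p. (d11 (fst p) + d12 (snd p), d21 (fst p) + d22 (snd p)))"
    by (intro bounded_linear_intros)
  then show ?thesis
    unfolding op_matrix_def by (subst bounded_linear_Blinfun_apply) (simp_all add: case_prod_unfold)
qed

definition blinfun_inverse :: "('a::real_normed_vector \<Rightarrow>\<^sub>L 'a) \<Rightarrow> ('a \<Rightarrow>\<^sub>L 'a)" where
  "blinfun_inverse T = (THE S. S o\<^sub>L T = id_blinfun \<and> T o\<^sub>L S = id_blinfun)"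

lemma blinfun_inverse_eqI:
  assumes "S o\<^sub>L T = id_blinfun" "T o\<^sub>L S = id_blinfun"
  shows "blinfun_inverse T = S"
  unfolding blinfun_inverse_def
proof (rule the_equality)
  fix S' assume S': "S' o\<^sub>L T = id_blinfun \<and> T o\<^sub>L S' = id_blinfun"
  have "S' = S' o\<^sub>L (T o\<^sub>L S)" unfolding assms by (rule blinfun_eqI) simp
  also have "\<dots> = (S' o\<^sub>L T) o\<^sub>L S" by (rule blinfun_eqI) simp
  also have "\<dots> = S" unfolding S'[THEN conjunct1] by (rule blinfun_eqI) simp
  finally show "S' = S" .
qed (use assms in simp)

lemma op_matrix_lower_inverse:
  "op_matrix id_blinfun 0 (- \<beta>21) id_blinfun o\<^sub>L op_matrix id_blinfun 0 \<beta>21 id_blinfun = id_blinfun"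
  "op_matrix id_blinfun 0 \<beta>21 id_blinfun o\<^sub>L op_matrix id_blinfun 0 (- \<beta>21) id_blinfun = id_blinfun"
  by (rule blinfun_eqI; auto simp: blinfun.bilinear_simps split: prod.splits)+

lemma op_matrix_upper_inverse:
  "op_matrix id_blinfun (- \<beta>12) 0 id_blinfun o\<^sub>L op_matrix id_blinfun \<beta>12 0 id_blinfun = id_blinfun"
  "op_matrix id_blinfun \<beta>12 0 id_blinfun o\<^sub>L op_matrix id_blinfun (- \<beta>12) 0 id_blinfun = id_blinfun"
  by (rule blinfun_eqI; auto simp: blinfun.bilinear_simps split: prod.splits)+

lemma blinfun_inverse_lower:
  "blinfun_inverse (op_matrix id_blinfun 0 \<beta>21 id_blinfun) = op_matrix id_blinfun 0 (- \<beta>21) id_blinfun"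
  by (rule blinfun_inverse_eqI) (fact op_matrix_lower_inverse)+

lemma blinfun_inverse_upper:
  "blinfun_inverse (op_matrix id_blinfun \<beta>12 0 id_blinfun) = op_matrix id_blinfun (- \<beta>12) 0 id_blinfun"
  by (rule blinfun_inverse_eqI) (fact op_matrix_upper_inverse)+

section \<open>Covariance operators\<close>

definition tensor_op :: "'a::real_inner \<Rightarrow> 'b::real_normed_vector \<Rightarrow> 'a \<Rightarrow>\<^sub>L 'b" where
  "tensor_op a b = Blinfun (\<lambda>x. (a \<bullet> x) *\<^sub>R b)"

lemma tensor_op_apply [simp]: "tensor_op a b x = (a \<bullet> x) *\<^sub>R b"
  unfolding tensor_op_def
  by (subst bounded_linear_Blinfun_apply) (auto intro!: bounded_linear_intros)

text \<open>
  \<open>cov_op M Z\<close> is \<open>E[Z \<otimes> Z]\<close>, which for a centred \<open>Z\<close> is the usual covariance operator.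
  The expectation is taken pointwise, \<open>E[Z \<otimes> Z] h = E[(Z \<otimes> Z) h]\<close>, because the Bochner integral
  needs a separable codomain and the space of bounded operators is not separable. The value is
  only meaningful if \<open>Z\<close> is measurable with \<open>E \<parallel>Z\<parallel>\<^sup>2 < \<infinity>\<close>.
\<close>

definition cov_op ::
  "'w measure \<Rightarrow> ('w \<Rightarrow> 'h::{real_inner, banach, second_countable_topology}) \<Rightarrow> 'h \<Rightarrow>\<^sub>L 'h" where
  "cov_op M Z = Blinfun (\<lambda>h. \<integral>\<omega>. tensor_op (Z \<omega>) (Z \<omega>) h \<partial>M)"

lemma cov_op_apply:
  fixes Z :: "'w \<Rightarrow> 'h::{real_inner, banach, second_countable_topology}"
  assumes [measurable]: "Z \<in> borel_measurable M" and int: "integrable M (\<lambda>\<omega>. (norm (Z \<omega>))\<^sup>2)"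
  shows "integrable M (\<lambda>\<omega>. (Z \<omega> \<bullet> h) *\<^sub>R Z \<omega>)"
    and "cov_op M Z h = (\<integral>\<omega>. (Z \<omega> \<bullet> h) *\<^sub>R Z \<omega> \<partial>M)"
proof -
  have bound: "norm ((Z \<omega> \<bullet> h) *\<^sub>R Z \<omega>) \<le> (norm (Z \<omega>))\<^sup>2 * norm h" for \<omega> h
    using mult_right_mono[OF Cauchy_Schwarz_ineq2[of "Z \<omega>" h], of "norm (Z \<omega>)"]
    by (simp add: power2_eq_square mult_ac)
  have integrable: "integrable M (\<lambda>\<omega>. (Z \<omega> \<bullet> h) *\<^sub>R Z \<omega>)" for h
  proof (rule Bochner_Integration.integrable_bound)
    show "integrable M (\<lambda>\<omega>. (norm (Z \<omega>))\<^sup>2 * norm h)" using int by simp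
    show "AE \<omega> in M. norm ((Z \<omega> \<bullet> h) *\<^sub>R Z \<omega>) \<le> norm ((norm (Z \<omega>))\<^sup>2 * norm h)"
      using bound by (intro AE_I2) simp
  qed measurable
  have "bounded_linear (\<lambda>h. \<integral>\<omega>. (Z \<omega> \<bullet> h) *\<^sub>R Z \<omega> \<partial>M)"
  proof (rule bounded_linear_intro[where K = "\<integral>\<omega>. (norm (Z \<omega>))\<^sup>2 \<partial>M"])
    fix g h :: 'h and c :: real
    show "(\<integral>\<omega>. (Z \<omega> \<bullet> (g + h)) *\<^sub>R Z \<omega> \<partial>M)
        = (\<integral>\<omega>. (Z \<omega> \<bullet> g) *\<^sub>R Z \<omega> \<partial>M) + (\<integral>\<omega>. (Z \<omega> \<bullet> h) *\<^sub>R Z \<omega> \<partial>M)"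
      by (simp add: inner_add_right scaleR_add_left integrable)
    show "(\<integral>\<omega>. (Z \<omega> \<bullet> (c *\<^sub>R h)) *\<^sub>R Z \<omega> \<partial>M) = c *\<^sub>R (\<integral>\<omega>. (Z \<omega> \<bullet> h) *\<^sub>R Z \<omega> \<partial>M)"
      by (simp flip: scaleR_scaleR)
    have "norm (\<integral>\<omega>. (Z \<omega> \<bullet> h) *\<^sub>R Z \<omega> \<partial>M) \<le> (\<integral>\<omega>. norm ((Z \<omega> \<bullet> h) *\<^sub>R Z \<omega>) \<partial>M)"
      by (rule integral_norm_bound)
    also have "\<dots> \<le> (\<integral>\<omega>. (norm (Z \<omega>))\<^sup>2 * norm h \<partial>M)"
      by (rule integral_mono[OF integrable_norm[OF integrable] _ bound]) (simp add: int)
    finally have "norm (\<integral>\<omega>. (Z \<omega> \<bullet> h) *\<^sub>R Z \<omega> \<partial>M) \<le> (\<integral>\<omega>. (norm (Z \<omega>))\<^sup>2 * norm h \<partial>M)" .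
    then show "norm (\<integral>\<omega>. (Z \<omega> \<bullet> h) *\<^sub>R Z \<omega> \<partial>M) \<le> norm h * (\<integral>\<omega>. (norm (Z \<omega>))\<^sup>2 \<partial>M)"
      by (simp add: mult.commute)
  qed
  then show "cov_op M Z h = (\<integral>\<omega>. (Z \<omega> \<bullet> h) *\<^sub>R Z \<omega> \<partial>M)"
    unfolding cov_op_def tensor_op_apply by (rule bounded_linear_Blinfun_apply[THEN fun_cong])
  show "integrable M (\<lambda>\<omega>. (Z \<omega> \<bullet> h) *\<^sub>R Z \<omega>)" by (rule integrable)
qed

section \<open>The structural model and its reduced form\<close>

definition svar_model ::
  "'w measure \<Rightarrow> (int \<Rightarrow> 'w \<Rightarrow> real) \<Rightarrow> (int \<Rightarrow> 'w \<Rightarrow> L2) \<Rightarrow>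
     (int \<Rightarrow> 'w \<Rightarrow> real) \<Rightarrow> (int \<Rightarrow> 'w \<Rightarrow> L2) \<Rightarrow>
     RH_op \<Rightarrow> RH_op \<Rightarrow> RH_op \<Rightarrow> bool" where
  "svar_model M y X u1 U2 A B S \<longleftrightarrow>
     prob_space M \<and>
     (\<forall>t. y t \<in> borel_measurable M \<and> X t \<in> borel_measurable M \<and>
          u1 t \<in> borel_measurable M \<and> U2 t \<in> borel_measurable M \<and>
          integrable M (\<lambda>\<omega>. (norm (u1 t \<omega>, U2 t \<omega>))\<^sup>2) \<and>
          (AE \<omega> in M. B (y t \<omega>, X t \<omega>) = A (y (t - 1) \<omega>, X (t - 1) \<omega>) + (u1 t \<omega>, U2 t \<omega>)) \<and>
          cov_op M (\<lambda>\<omega>. (u1 t \<omega>, U2 t \<omega>)) = S)"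

text \<open>
  In the two definitions below \<open>blinfun_inverse B\<close> is a genuine inverse whenever one of the
  off-diagonal blocks of \<open>B\<close> vanishes, by \<open>op_matrix_lower_inverse\<close> and \<open>op_matrix_upper_inverse\<close>.
\<close>

definition reduced_coeff ::
  "RH_op \<Rightarrow> RH_op \<Rightarrow> RH_op" where
  "reduced_coeff A B = blinfun_inverse B o\<^sub>L A"

definition reduced_error ::
  "RH_op \<Rightarrow> (int \<Rightarrow> 'w \<Rightarrow> real) \<Rightarrow> (int \<Rightarrow> 'w \<Rightarrow> L2) \<Rightarrow> int \<Rightarrow> 'w \<Rightarrow> real \<times> L2" where
  "reduced_error B u1 U2 t \<omega> = blinfun_inverse B (u1 t \<omega>, U2 t \<omega>)"

definition reduced_form_parameters ::
  "'w measure \<Rightarrow> (int \<Rightarrow> 'w \<Rightarrow> real) \<Rightarrow> (int \<Rightarrow> 'w \<Rightarrow> L2) \<Rightarrow>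
     RH_op \<Rightarrow> RH_op \<Rightarrow>
     RH_op \<Rightarrow> RH_op \<Rightarrow> bool" where
  "reduced_form_parameters M u1 U2 A B \<Gamma> S\<epsilon> \<longleftrightarrow>
     \<Gamma> = reduced_coeff A B \<and> (\<forall>t. cov_op M (reduced_error B u1 U2 t) = S\<epsilon>)"

lemma reduced_form_equation:
  assumes "svar_model M y X u1 U2 A B S" "blinfun_inverse B o\<^sub>L B = id_blinfun"
  shows "AE \<omega> in M. (y t \<omega>, X t \<omega>)
    = reduced_coeff A B (y (t - 1) \<omega>, X (t - 1) \<omega>) + reduced_error B u1 U2 t \<omega>"
proof -
  have "AE \<omega> in M. B (y t \<omega>, X t \<omega>) = A (y (t - 1) \<omega>, X (t - 1) \<omega>) + (u1 t \<omega>, U2 t \<omega>)"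
    using assms(1) unfolding svar_model_def by blast
  then show ?thesis
  proof eventually_elim
    fix \<omega> assume *: "B (y t \<omega>, X t \<omega>) = A (y (t - 1) \<omega>, X (t - 1) \<omega>) + (u1 t \<omega>, U2 t \<omega>)"
    have "(y t \<omega>, X t \<omega>) = (blinfun_inverse B o\<^sub>L B) (y t \<omega>, X t \<omega>)" by (simp add: assms(2))
    also have "\<dots> = blinfun_inverse B (B (y t \<omega>, X t \<omega>))" by (rule blinfun_apply_blinfun_compose)
    finally show "(y t \<omega>, X t \<omega>)
        = reduced_coeff A B (y (t - 1) \<omega>, X (t - 1) \<omega>) + reduced_error B u1 U2 t \<omega>"
      unfolding * reduced_coeff_def reduced_error_def
      by (simp add: blinfun.add_right)
  qed
qed

end

theory Submission
  imports Defs
begin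

text \<open>
  Since \<open>\<epsilon> = B\<^sup>-\<^sup>1 u\<close>, the two covariance operators are related by \<open>S\<^sub>\<epsilon> = B\<^sup>-\<^sup>1 S (B\<^sup>-\<^sup>1)\<^sup>*\<close>, so
  \<open>S\<close> and \<open>A = B \<Gamma>\<close> are determined once \<open>B\<close> is. If \<open>\<beta>\<^sub>1\<^sub>2 = 0\<close>, the first column of \<open>S\<^sub>\<epsilon>\<close> is
  \<open>(\<sigma>\<^sub>1\<^sub>1, - \<beta>\<^sub>2\<^sub>1 \<sigma>\<^sub>1\<^sub>1)\<close>, which gives \<open>\<beta>\<^sub>2\<^sub>1\<close> provided \<open>\<sigma>\<^sub>1\<^sub>1 \<noteq> 0\<close>. If \<open>\<beta>\<^sub>2\<^sub>1 = 0\<close>, the second column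
  is \<open>(- \<beta>\<^sub>1\<^sub>2 \<Sigma>\<^sub>2\<^sub>2, \<Sigma>\<^sub>2\<^sub>2)\<close>. Writing \<open>\<beta>\<^sub>1\<^sub>2 = \<langle>c, \<cdot>\<rangle>\<close> by the Riesz representation theorem,
  \<open>\<beta>\<^sub>1\<^sub>2 \<Sigma>\<^sub>2\<^sub>2 = \<langle>\<Sigma>\<^sub>2\<^sub>2 c, \<cdot>\<rangle>\<close> by symmetry, so injectivity of \<open>\<Sigma>\<^sub>2\<^sub>2\<close> determines \<open>c\<close>.
\<close>

section \<open>Riesz representation\<close>

text \<open>
  The representing vector is the minimiser of the strictly convex functional \<open>\<parallel>x\<parallel>\<^sup>2 - 2 f x\<close>;
  the parallelogram law makes every minimising sequence Cauchy.
\<close>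

lemma riesz_representation:
  fixes f :: "'h::{real_inner, complete_space} \<Rightarrow>\<^sub>L real"
  obtains c where "\<And>x. f x = c \<bullet> x"
proof -
  define J where "J x = (norm x)\<^sup>2 - 2 * f x" for x
  have parallelogram: "(norm (x - y))\<^sup>2 = 2 * (J x + J y - 2 * J ((1/2) *\<^sub>R (x + y)))" for x y
    by (simp add: J_def power2_norm_eq_inner blinfun.add_right blinfun.scaleR_right
        inner_diff inner_add inner_commute algebra_simps)
  \<comment> \<open>Completing the square, \<open>J x\<close> is at least
    \<open>(norm x - norm f)\<^sup>2 - (norm f)\<^sup>2\<close>.\<close>
  have "- (norm f)\<^sup>2 \<le> J x" for x
  proof -
    have "f x \<le> norm f * norm x"
      using norm_blinfun[of f x] by simp
    then show ?thesis
      using zero_le_power2[of "norm x - norm f"] by (simp add: J_def power2_diff algebra_simps)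
  qed
  then have bdd: "bdd_below (range J)" by (auto simp: bdd_below_def)
  define m where "m = Inf (range J)"
  have m_le: "m \<le> J x" for x
    unfolding m_def by (intro cInf_lower bdd) simp
  have "\<exists>x. J x < m + inverse (real (Suc n))" for n
    using cInf_lessD[of "range J" "m + inverse (real (Suc n))"] by (auto simp flip: m_def)
  then obtain s where s: "\<And>n. J (s n) < m + inverse (real (Suc n))" by metis
  have "Cauchy s"
  proof (rule metric_CauchyI)
    fix e :: real assume "0 < e"
    \<comment> \<open>In the parallelogram identity, two values below
      \<open>m + e\<^sup>2 / 4\<close> and a midpoint value of at least \<open>m\<close> keep the
      squared distance below \<open>2 * (e\<^sup>2 / 2)\<close>.\<close>
    then obtain n0 where n0: "inverse (real (Suc n0)) < e\<^sup>2 / 4"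
      using reals_Archimedean[of "e\<^sup>2 / 4"] by auto
    have close: "J (s n) < m + e\<^sup>2 / 4" if "n \<ge> n0" for n
    proof -
      have "inverse (real (Suc n)) \<le> inverse (real (Suc n0))" using that by simp
      with s[of n] n0 show ?thesis by linarith
    qed
    have "dist (s i) (s j) < e" if "i \<ge> n0" "j \<ge> n0" for i j
    proof -
      have "(norm (s i - s j))\<^sup>2 < e\<^sup>2"
        using parallelogram[of "s i" "s j"] close[OF that(1)] close[OF that(2)]
          m_le[of "(1/2) *\<^sub>R (s i + s j)"] by (simp add: field_simps)
      then show ?thesis
        using \<open>0 < e\<close> by (simp add: dist_norm power_less_imp_less_base)
    qed
    then show "\<exists>n0. \<forall>i\<ge>n0. \<forall>j\<ge>n0. dist (s i) (s j) < e" by blast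
  qed
  then obtain c where "s \<longlonglongrightarrow> c"
    using Cauchy_convergent convergent_def by blast
  then have "(\<lambda>n. J (s n)) \<longlonglongrightarrow> J c"
    unfolding J_def by (intro tendsto_intros)
  moreover have "(\<lambda>n. m + inverse (real (Suc n))) \<longlonglongrightarrow> m"
    using tendsto_add[OF tendsto_const LIMSEQ_inverse_real_of_nat, of m] by simp
  ultimately have Jc: "J c \<le> m"
    by (rule LIMSEQ_le) (use s less_imp_le in blast)
  have "f h = c \<bullet> h" for h
  proof -
    define d where "d = c \<bullet> h - f h"
    \<comment> \<open>The quadratic in \<open>t\<close> is tested at \<open>- d / q\<close> in place
      of its minimiser \<open>- d / (norm h)\<^sup>2\<close>; the added 1 keeps \<open>q\<close>
      nonzero when \<open>h = 0\<close>.\<close>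
    define q where "q = 1 + (norm h)\<^sup>2"
    have "q \<ge> 1" by (simp add: q_def)
    have "J (c + t *\<^sub>R h) = J c + 2 * t * d + t\<^sup>2 * (norm h)\<^sup>2" for t
      unfolding J_def d_def power2_norm_eq_inner
      by (simp add: blinfun.add_right blinfun.scaleR_right inner_add inner_commute power2_eq_square
          algebra_simps)
    then have "0 \<le> 2 * t * d + t\<^sup>2 * (norm h)\<^sup>2" for t
      using m_le[of "c + t *\<^sub>R h"] Jc by simp
    from this[of "- d / q"] have "0 \<le> q\<^sup>2 * (2 * (- d / q) * d + (- d / q)\<^sup>2 * (q - 1))"
      by (simp add: q_def)
    also have "\<dots> = - (d\<^sup>2 * (q + 1))"
      using \<open>q \<ge> 1\<close> by (simp add: field_simps power2_eq_square)
    finally have "d\<^sup>2 * (q + 1) \<le> 0" by simp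
    then have "d = 0"
      using \<open>q \<ge> 1\<close> by (auto simp: mult_le_0_iff)
    then show ?thesis by (simp add: d_def)
  qed
  then show ?thesis by (rule that)
qed

section \<open>Covariance operators and bounded linear maps\<close>

text \<open>Both sides are the expectation of
  \<open>(Z \<omega> \<bullet> g) * (Z \<omega> \<bullet> h)\<close>.\<close>

lemma cov_op_symmetric:
  fixes Z :: "'w \<Rightarrow> 'h::{real_inner, banach, second_countable_topology}"
  assumes "Z \<in> borel_measurable M" "integrable M (\<lambda>\<omega>. (norm (Z \<omega>))\<^sup>2)"
  shows "cov_op M Z g \<bullet> h = g \<bullet> cov_op M Z h"
proof -
  note cov = cov_op_apply[OF assms]
  have "cov_op M Z g \<bullet> h = (\<integral>\<omega>. (Z \<omega> \<bullet> g) * (Z \<omega> \<bullet> h) \<partial>M)"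
    using integral_inner_left[OF cov(1), of g h] by (simp add: cov(2))
  also have "\<dots> = g \<bullet> cov_op M Z h"
    using integral_inner_right[OF cov(1), of g h] by (simp add: cov(2) mult.commute inner_commute)
  finally show ?thesis .
qed

text \<open>The vector \<open>h'\<close> stands for the adjoint of \<open>T\<close> applied to
  \<open>h\<close>; asking for it at this one \<open>h\<close> avoids constructing the adjoint. Then
  \<open>T\<close> is pulled out of the integral.\<close>

lemma cov_op_blinfun:
  fixes Z :: "'w \<Rightarrow> 'h::{real_inner, banach, second_countable_topology}"
    and T :: "'h \<Rightarrow>\<^sub>L 'g::{real_inner, banach, second_countable_topology}"
  assumes [measurable]: "Z \<in> borel_measurable M" and int: "integrable M (\<lambda>\<omega>. (norm (Z \<omega>))\<^sup>2)"
    and adjoint: "\<And>z. T z \<bullet> h = z \<bullet> h'"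
  shows "cov_op M (\<lambda>\<omega>. T (Z \<omega>)) h = T (cov_op M Z h')"
proof -
  have TZ [measurable]: "(\<lambda>\<omega>. T (Z \<omega>)) \<in> borel_measurable M"
    by (rule borel_measurable_continuous_on[OF _ assms(1)]) (intro continuous_intros)
  have "integrable M (\<lambda>\<omega>. (norm (T (Z \<omega>)))\<^sup>2)"
  proof (rule Bochner_Integration.integrable_bound)
    show "integrable M (\<lambda>\<omega>. (norm T)\<^sup>2 * (norm (Z \<omega>))\<^sup>2)" using int by simp
    show "AE \<omega> in M. norm ((norm (T (Z \<omega>)))\<^sup>2) \<le> norm ((norm T)\<^sup>2 * (norm (Z \<omega>))\<^sup>2)"
      using power_mono[OF norm_blinfun norm_ge_zero, of T _ 2] by (simp add: power_mult_distrib)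
  qed measurable
  from cov_op_apply(2)[OF TZ this]
  have "cov_op M (\<lambda>\<omega>. T (Z \<omega>)) h = (\<integral>\<omega>. T ((Z \<omega> \<bullet> h') *\<^sub>R Z \<omega>) \<partial>M)"
    by (simp add: adjoint blinfun.scaleR_right)
  also have "\<dots> = T (cov_op M Z h')"
    using integral_bounded_linear[OF blinfun.bounded_linear_right cov_op_apply(1)[OF assms(1) int]]
    by (simp add: cov_op_apply(2)[OF assms(1) int])
  finally show ?thesis .
qed

lemma real_blinfun_eq_scaleR:
  fixes f :: "real \<Rightarrow>\<^sub>L 'a::real_normed_vector"
  shows "f r = r *\<^sub>R f 1"
  using blinfun.scaleR_right[of f r 1] by simp

section \<open>Reduced-form parameters in terms of structural ones\<close>

lemma svar_model_shockD:
  assumes "svar_model M y X u1 U2 A B S"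
  shows "(\<lambda>\<omega>. (u1 t \<omega>, U2 t \<omega>)) \<in> borel_measurable M"
    and "integrable M (\<lambda>\<omega>. (norm (u1 t \<omega>, U2 t \<omega>))\<^sup>2)"
    and "cov_op M (\<lambda>\<omega>. (u1 t \<omega>, U2 t \<omega>)) = S"
  using assms unfolding svar_model_def by (auto intro: borel_measurable_Pair)

lemma svar_model_symmetric:
  assumes "svar_model M y X u1 U2 A B S"
  shows "S g \<bullet> h = g \<bullet> S h"
  using cov_op_symmetric[OF svar_model_shockD(1,2)[OF assms]] svar_model_shockD(3)[OF assms] by metis

lemma reduced_cov_apply:
  assumes "svar_model M y X u1 U2 A B S" "reduced_form_parameters M u1 U2 A B \<Gamma> S\<epsilon>"
    and "\<And>z. blinfun_inverse B z \<bullet> h = z \<bullet> h'"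
  shows "S\<epsilon> h = blinfun_inverse B (S h')"
proof -
  \<comment> \<open>Date 0 is arbitrary, since neither covariance operator depends on the
    date.\<close>
  have "S\<epsilon> = cov_op M (\<lambda>\<omega>. blinfun_inverse B (u1 0 \<omega>, U2 0 \<omega>))"
    using assms(2) unfolding reduced_form_parameters_def reduced_error_def[abs_def] by auto
  then show ?thesis
    using cov_op_blinfun[OF svar_model_shockD(1,2)[OF assms(1)] assms(3)]
    by (simp add: svar_model_shockD(3)[OF assms(1)])
qed

lemma structural_coeff_eq:
  assumes "reduced_form_parameters M u1 U2 A B \<Gamma> S\<epsilon>" "B o\<^sub>L blinfun_inverse B = id_blinfun"
  shows "A = B o\<^sub>L \<Gamma>"
proof -
  have "B o\<^sub>L \<Gamma> = (B o\<^sub>L blinfun_inverse B) o\<^sub>L A"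
    using assms(1) unfolding reduced_form_parameters_def reduced_coeff_def
    by (auto intro!: blinfun_eqI)
  then show ?thesis by (auto simp: assms(2) intro!: blinfun_eqI)
qed

text \<open>The adjoint of \<open>blinfun_inverse B\<close> sends \<open>(r, k)\<close> to
  \<open>(r - \<beta>21 1 \<bullet> k, k)\<close>. The two arguments are those that it maps to
  \<open>(0, k)\<close> and \<open>(1, 0)\<close>, where \<open>S\<close> shows one block at a
  time.\<close>

lemma reduced_cov_lower:
  assumes "B = op_matrix id_blinfun 0 \<beta>21 id_blinfun" "S = op_matrix \<sigma>11 0 0 \<Sigma>22"
    and "svar_model M y X u1 U2 A B S" "reduced_form_parameters M u1 U2 A B \<Gamma> S\<epsilon>"
  shows "S\<epsilon> (\<beta>21 1 \<bullet> k, k) = (0, \<Sigma>22 k)" and "S\<epsilon> (1, 0) = (\<sigma>11 1, - \<beta>21 (\<sigma>11 1))"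
proof -
  have inverse: "blinfun_inverse B = op_matrix id_blinfun 0 (- \<beta>21) id_blinfun"
    unfolding assms(1) by (rule blinfun_inverse_lower)
  have adjoint: "blinfun_inverse B z \<bullet> (r, k) = z \<bullet> (r - \<beta>21 1 \<bullet> k, k)" for z r k
    using real_blinfun_eq_scaleR[of \<beta>21 "fst z"]
    by (cases z) (simp add: inverse blinfun.minus_left inner_add_left algebra_simps)
  show "S\<epsilon> (\<beta>21 1 \<bullet> k, k) = (0, \<Sigma>22 k)"
    using reduced_cov_apply[OF assms(3,4) adjoint]
    by (simp add: inverse assms(2) blinfun.zero_right)
  show "S\<epsilon> (1, 0) = (\<sigma>11 1, - \<beta>21 (\<sigma>11 1))"
    using reduced_cov_apply[OF assms(3,4) adjoint]
    by (simp add: inverse assms(2) blinfun.zero_right blinfun.minus_left)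
qed

text \<open>Here the adjoint sends \<open>(r, k)\<close> to \<open>(r, k - r *\<^sub>R c)\<close>,
  so the arguments mapped to \<open>(0, k)\<close> and \<open>(1, 0)\<close> are
  \<open>(0, k)\<close> and \<open>(1, c)\<close>.\<close>

lemma reduced_cov_upper:
  assumes "B = op_matrix id_blinfun \<beta>12 0 id_blinfun" "S = op_matrix \<sigma>11 0 0 \<Sigma>22"
    and "svar_model M y X u1 U2 A B S" "reduced_form_parameters M u1 U2 A B \<Gamma> S\<epsilon>"
    and "\<And>x. \<beta>12 x = c \<bullet> x"
  shows "S\<epsilon> (0, k) = (- (c \<bullet> \<Sigma>22 k), \<Sigma>22 k)" and "S\<epsilon> (1, c) = (\<sigma>11 1, 0)"
proof -
  have inverse: "blinfun_inverse B = op_matrix id_blinfun (- \<beta>12) 0 id_blinfun"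
    unfolding assms(1) by (rule blinfun_inverse_upper)
  have adjoint: "blinfun_inverse B z \<bullet> (r, k) = z \<bullet> (r, k - r *\<^sub>R c)" for z r k
    by (cases z) (simp add: inverse blinfun.minus_left assms(5) inner_diff_right inner_commute
        algebra_simps)
  show "S\<epsilon> (0, k) = (- (c \<bullet> \<Sigma>22 k), \<Sigma>22 k)"
    using reduced_cov_apply[OF assms(3,4) adjoint]
    by (simp add: inverse assms(2,5) blinfun.zero_right blinfun.minus_left)
  show "S\<epsilon> (1, c) = (\<sigma>11 1, 0)"
    using reduced_cov_apply[OF assms(3,4) adjoint]
    by (simp add: inverse assms(2) blinfun.zero_right)
qed

section \<open>Identification\<close>

lemma identified_lower:
  assumes "B = op_matrix id_blinfun 0 \<beta>21 id_blinfun" "S = op_matrix \<sigma>11 0 0 \<Sigma>22"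
    and "svar_model M y X u1 U2 A B S" "reduced_form_parameters M u1 U2 A B \<Gamma> S\<epsilon>"
    and "B' = op_matrix id_blinfun 0 \<beta>21' id_blinfun" "S' = op_matrix \<sigma>11' 0 0 \<Sigma>22'"
    and "svar_model M' y' X' u1' U2' A' B' S'" "reduced_form_parameters M' u1' U2' A' B' \<Gamma> S\<epsilon>"
    and "\<sigma>11 \<noteq> 0"
  shows "A = A' \<and> B = B' \<and> S = S'"
proof -
  note cov = reduced_cov_lower[OF assms(1-4)] and cov' = reduced_cov_lower[OF assms(5-8)]
  have \<sigma>1: "\<sigma>11 1 = \<sigma>11' 1" and "\<beta>21 (\<sigma>11 1) = \<beta>21' (\<sigma>11 1)"
    using cov(2) cov'(2) by auto
  \<comment> \<open>A linear map on the reals is multiplication by its value at 1.\<close>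
  moreover have "\<sigma>11 1 \<noteq> 0"
    using \<open>\<sigma>11 \<noteq> 0\<close> by (metis blinfun_eqI real_blinfun_eq_scaleR scaleR_zero_right zero_blinfun.rep_eq)
  ultimately have "\<beta>21 1 = \<beta>21' 1"
    using real_blinfun_eq_scaleR[of \<beta>21 "\<sigma>11 1"] real_blinfun_eq_scaleR[of \<beta>21' "\<sigma>11 1"] by simp
  then have \<beta>: "\<beta>21 = \<beta>21'"
    by (intro blinfun_eqI) (metis real_blinfun_eq_scaleR)
  have "\<sigma>11 = \<sigma>11'"
    using \<sigma>1 by (intro blinfun_eqI) (metis real_blinfun_eq_scaleR)
  \<comment> \<open>With \<open>\<beta>21\<close> known, both models read off this block at the same
    vectors \<open>(\<beta>21 1 \<bullet> k, k)\<close>.\<close>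
  moreover have "\<Sigma>22 = \<Sigma>22'"
    using cov(1) cov'(1) by (intro blinfun_eqI) (simp add: \<beta>)
  moreover have "B = B'" by (simp add: assms(1,5) \<beta>)
  moreover have "A = A'"
    using structural_coeff_eq[OF assms(4)] structural_coeff_eq[OF assms(8)]
    by (simp add: assms(1,5) \<beta> blinfun_inverse_lower op_matrix_lower_inverse)
  ultimately show ?thesis by (simp add: assms(2,6))
qed

lemma identified_upper:
  assumes "B = op_matrix id_blinfun \<beta>12 0 id_blinfun" "S = op_matrix \<sigma>11 0 0 \<Sigma>22"
    and "svar_model M y X u1 U2 A B S" "reduced_form_parameters M u1 U2 A B \<Gamma> S\<epsilon>"
    and "B' = op_matrix id_blinfun \<beta>12' 0 id_blinfun" "S' = op_matrix \<sigma>11' 0 0 \<Sigma>22'"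
    and "svar_model M' y' X' u1' U2' A' B' S'" "reduced_form_parameters M' u1' U2' A' B' \<Gamma> S\<epsilon>"
    and "inj \<Sigma>22"
  shows "A = A' \<and> B = B' \<and> S = S'"
proof -
  obtain c c' where c: "\<And>x. \<beta>12 x = c \<bullet> x" and c': "\<And>x. \<beta>12' x = c' \<bullet> x"
    using riesz_representation by metis
  note cov = reduced_cov_upper[OF assms(1-4) c] and cov' = reduced_cov_upper[OF assms(5-8) c']
  have \<Sigma>: "\<Sigma>22 = \<Sigma>22'"
    using cov(1) cov'(1) by (intro blinfun_eqI) simp
  \<comment> \<open>The diagonal block inherits the symmetry of the covariance operator
    \<open>S\<close>.\<close>
  have symmetric: "\<Sigma>22 g \<bullet> h = g \<bullet> \<Sigma>22 h" for g h
    using svar_model_symmetric[OF assms(3), of "(0, g)" "(0, h)"]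
    by (simp add: assms(2) blinfun.zero_right)
  have "c \<bullet> \<Sigma>22 k = c' \<bullet> \<Sigma>22 k" for k
    using cov(1)[of k] cov'(1)[of k] by (simp add: \<Sigma>)
  then have "\<Sigma>22 c \<bullet> k = \<Sigma>22 c' \<bullet> k" for k
    by (simp add: symmetric)
  then have "\<Sigma>22 c = \<Sigma>22 c'"
    using vector_eq_rdot[of "\<Sigma>22 c" "\<Sigma>22 c'"] by blast
  then have "c = c'"
    using \<open>inj \<Sigma>22\<close> by (simp add: inj_eq)
  then have \<beta>: "\<beta>12 = \<beta>12'"
    by (intro blinfun_eqI) (simp add: c c')
  \<comment> \<open>Now that \<open>c = c'\<close>, both models evaluate \<open>S\<epsilon>\<close>
    at the same vector \<open>(1, c)\<close>.\<close>
  have "\<sigma>11 1 = \<sigma>11' 1"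
    using cov(2) cov'(2) \<open>c = c'\<close> by simp
  then have "\<sigma>11 = \<sigma>11'"
    by (intro blinfun_eqI) (metis real_blinfun_eq_scaleR)
  moreover have "B = B'" by (simp add: assms(1,5) \<beta>)
  moreover have "A = A'"
    using structural_coeff_eq[OF assms(4)] structural_coeff_eq[OF assms(8)]
    by (simp add: assms(1,5) \<beta> blinfun_inverse_upper op_matrix_upper_inverse)
  ultimately show ?thesis by (simp add: assms(2,6) \<Sigma>)
qed

text \<open>Identification is injectivity of the map to \<open>(\<Gamma>, S\<epsilon>)\<close>, so
  two models are compared, possibly on different probability spaces, under the same condition. The
  first condition includes \<open>\<sigma>11 \<noteq> 0\<close>: for \<open>\<beta>12 = 0\<close>
  and \<open>\<sigma>11 = 0\<close> the operator \<open>S\<epsilon>\<close> does not involve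
  \<open>\<beta>21\<close>, and a free \<open>A\<close> can produce the same \<open>\<Gamma>\<close>
  with any \<open>\<beta>21\<close>.\<close>

theorem proposition1:
  fixes M :: "'w measure" and M' :: "'v measure"
    and y :: "int \<Rightarrow> 'w \<Rightarrow> real" and X :: "int \<Rightarrow> 'w \<Rightarrow> L2"
    and u1 :: "int \<Rightarrow> 'w \<Rightarrow> real" and U2 :: "int \<Rightarrow> 'w \<Rightarrow> L2"
    and y' :: "int \<Rightarrow> 'v \<Rightarrow> real" and X' :: "int \<Rightarrow> 'v \<Rightarrow> L2"
    and u1' :: "int \<Rightarrow> 'v \<Rightarrow> real" and U2' :: "int \<Rightarrow> 'v \<Rightarrow> L2"
    and \<alpha>11 \<alpha>11' \<sigma>11 \<sigma>11' :: "real \<Rightarrow>\<^sub>L real"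
    and \<alpha>12 \<alpha>12' \<beta>12 \<beta>12' :: "L2 \<Rightarrow>\<^sub>L real"
    and \<alpha>21 \<alpha>21' \<beta>21 \<beta>21' :: "real \<Rightarrow>\<^sub>L L2"
    and \<alpha>22 \<alpha>22' \<Sigma>22 \<Sigma>22' :: "L2 \<Rightarrow>\<^sub>L L2"
    and A A' B B' S S' \<Gamma> S\<epsilon> :: RH_op
  assumes "A = op_matrix \<alpha>11 \<alpha>12 \<alpha>21 \<alpha>22"
    and "B = op_matrix id_blinfun \<beta>12 \<beta>21 id_blinfun"
    and "S = op_matrix \<sigma>11 0 0 \<Sigma>22"
    and "svar_model M y X u1 U2 A B S"
    and "reduced_form_parameters M u1 U2 A B \<Gamma> S\<epsilon>"
    and "A' = op_matrix \<alpha>11' \<alpha>12' \<alpha>21' \<alpha>22'"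
    and "B' = op_matrix id_blinfun \<beta>12' \<beta>21' id_blinfun"
    and "S' = op_matrix \<sigma>11' 0 0 \<Sigma>22'"
    and "svar_model M' y' X' u1' U2' A' B' S'"
    and "reduced_form_parameters M' u1' U2' A' B' \<Gamma> S\<epsilon>"
    and "(\<beta>12 = 0 \<and> \<sigma>11 \<noteq> 0) \<and> (\<beta>12' = 0 \<and> \<sigma>11' \<noteq> 0) \<or>
         (\<beta>21 = 0 \<and> inj \<Sigma>22) \<and> (\<beta>21' = 0 \<and> inj \<Sigma>22')"
  shows "A = A' \<and> B = B' \<and> S = S'"
  using assms(11)
proof (elim disjE conjE)
  assume "\<beta>12 = 0" "\<beta>12' = 0" "\<sigma>11 \<noteq> 0"
  then show ?thesis
    using identified_lower[OF _ assms(3-5) _ assms(8-10)] assms(2,7) by simp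
next
  assume "\<beta>21 = 0" "\<beta>21' = 0" "inj \<Sigma>22"
  then show ?thesis
    using identified_upper[OF _ assms(3-5) _ assms(8-10)] assms(2,7) by simp
qed

end
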